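(* Let $\kappa\geq\omega$ be a regular cardinal and let $\mathbb P=\langle P,\leq\rangle$ be a poset of size $\kappa$ which is both upwards and downwards $<\!\kappa$-directed. Suppose that (i) $\forall p,q\in P\ (p\leq q\Rightarrow\exists a\in P\ \ a\parallel[p,q])$; (ii) $\forall p,q,r\in P\ \exists\eta\in\mathrm{Pc}(\mathbb P)\ \ \eta:[p,q]\to(\cdot,r]$; (iii) $\forall p,q,r\in P\ \exists\eta\in\mathrm{Pc}(\mathbb P)\ \ \eta:[p,q]\to[r,\cdot)$. Then $\mathbb P$ is not reversible.
   Context: A poset $\mathbb P=\langle P,\leq\rangle$ is reversible iff each bijection $f:P\to P$ with $x\leq y\Rightarrow f(x)\leq f(y)$ for all $x,y$ is an automorphism. $\mathbb P$ is upwards (resp. downwards) $<\!\kappa$-directed iff each $S\subset P$ of size $<\kappa$ has an upper (resp. lower) bound in $P$. $[p,q]=\{x:p\leq x\leq q\}$, $(\cdot,r]=\{x:x\leq r\}$, $[r,\cdot)=\{x:r\leq x\}$. For $a\in P$ and $B\subset P$, $a\parallel B$ means that $a\not\leq b$ and $b\not\leq a$ for all $b\in B$. $\mathrm{Pc}(\mathbb P)$ is the set of partial condensations of $\mathbb P$: bijections $\eta$ from a set $\mathrm{dom}(\eta)\subset P$ onto a set $\mathrm{ran}(\eta)\subset P$ with $x\leq y\Rightarrow\eta(x)\leq\eta(y)$ for all $x,y\in\mathrm{dom}(\eta)$. The notation $\eta:A\to B$ for $\eta\in\mathrm{Pc}(\mathbb P)$ means $\mathrm{dom}(\eta)=A$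 and $\mathrm{ran}(\eta)\subset B$. *)

theory Defs
  imports Main
begin

unbundle cardinal_syntax

text \<open>
  A poset is a carrier \<open>P\<close> with \<open>partial_order_on P R\<close>, where \<open>(x, y) \<in> R\<close> means \<open>x \<le> y\<close>.  Since this
  includes \<open>R \<subseteq> P \<times> P\<close>, the library's \<open>under R r\<close> and \<open>above R r\<close> are the half-lines \<open>(\<cdot>, r]\<close> and
  \<open>[r, \<cdot>)\<close> of the poset.
\<close>

definition closed_interval :: "'a rel \<Rightarrow> 'a \<Rightarrow> 'a \<Rightarrow> 'a set"
  where "closed_interval R p q = {x. (p, x) \<in> R \<and> (x, q) \<in> R}"

definition poset_automorphism :: "'a set \<Rightarrow> 'a rel \<Rightarrow> ('a \<Rightarrow> 'a) \<Rightarrow> bool"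
  where "poset_automorphism P R f \<longleftrightarrow>
    bij_betw f P P \<and> (\<forall>x\<in>P. \<forall>y\<in>P. (x, y) \<in> R \<longleftrightarrow> (f x, f y) \<in> R)"

definition reversible :: "'a set \<Rightarrow> 'a rel \<Rightarrow> bool"
  where "reversible P R \<longleftrightarrow>
    (\<forall>f. bij_betw f P P \<and> (\<forall>x\<in>P. \<forall>y\<in>P. (x, y) \<in> R \<longrightarrow> (f x, f y) \<in> R)
      \<longrightarrow> poset_automorphism P R f)"

text \<open>A cardinal \<open>\<kappa>\<close> is a cardinal well-order, so \<open>|S| <o \<kappa>\<close> says that \<open>S\<close> has size less than \<open>\<kappa>\<close>.\<close>

definition upwards_directed :: "'k rel \<Rightarrow> 'a set \<Rightarrow> 'a rel \<Rightarrow> bool"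
  where "upwards_directed \<kappa> P R \<longleftrightarrow>
    (\<forall>S. S \<subseteq> P \<and> |S| <o \<kappa> \<longrightarrow> (\<exists>u\<in>P. \<forall>s\<in>S. (s, u) \<in> R))"

definition downwards_directed :: "'k rel \<Rightarrow> 'a set \<Rightarrow> 'a rel \<Rightarrow> bool"
  where "downwards_directed \<kappa> P R \<longleftrightarrow>
    (\<forall>S. S \<subseteq> P \<and> |S| <o \<kappa> \<longrightarrow> (\<exists>l\<in>P. \<forall>s\<in>S. (l, s) \<in> R))"

definition incomparable_to_set :: "'a rel \<Rightarrow> 'a \<Rightarrow> 'a set \<Rightarrow> bool"
  where "incomparable_to_set R a B \<longleftrightarrow> (\<forall>b\<in>B. (a, b) \<notin> R \<and> (b, a) \<notin> R)"

text \<open>The set \<open>Pc(P)\<close>; a bijection between two subsets of \<open>P\<close> is a partial map injective on its domain.\<close>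

definition partial_condensations :: "'a set \<Rightarrow> 'a rel \<Rightarrow> ('a \<rightharpoonup> 'a) set"
  where "partial_condensations P R =
    {\<eta>. dom \<eta> \<subseteq> P \<and> ran \<eta> \<subseteq> P \<and> inj_on \<eta> (dom \<eta>) \<and>
      (\<forall>x\<in>dom \<eta>. \<forall>y\<in>dom \<eta>. (x, y) \<in> R \<longrightarrow> (the (\<eta> x), the (\<eta> y)) \<in> R)}"

end

theory Submission
  imports Defs
begin

text \<open>
  The bijection is built by a back-and-forth recursion of length \<open>\<kappa>\<close> through condensations with
  convex bounded domain and bounded range.  To extend the domain to an interval \<open>I\<close>, send the points
  of \<open>I\<close> that lie below some old point strictly below the old range, by (ii), and all other new
  points strictly above it, by (iii); convexity of the old domain makes this order preserving.  To
  extend the range, pull the new value back to a point incomparable to the domain, by (i), which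
  keeps the domain convex.  Limits stay bounded by directedness.  Starting with two incomparable
  points sent to comparable ones, the limit is not an automorphism.
\<close>

section \<open>Directedness and sets of size below \<kappa>\<close>

locale two_way_directed_poset =
  fixes \<kappa> :: "'k rel" and P :: "'a set" and R :: "'a rel"
  assumes natLeq_kappa: "natLeq \<le>o \<kappa>"
    and po: "partial_order_on P R"
    and card_P: "|P| =o \<kappa>"
    and up_directed: "upwards_directed \<kappa> P R"
    and down_directed: "downwards_directed \<kappa> P R"
    and ex_incomparable: "\<And>p q. \<lbrakk>p \<in> P; q \<in> P; (p, q) \<in> R\<rbrakk> \<Longrightarrow>
      \<exists>a\<in>P. incomparable_to_set R a (closed_interval R p q)"
    and into_under: "\<And>p q r. \<lbrakk>p \<in> P; q \<in> P; r \<in> P\<rbrakk> \<Longrightarrow> \<exists>\<eta>\<in>partial_condensations P R.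
      dom \<eta> = closed_interval R p q \<and> ran \<eta> \<subseteq> under R r"
    and into_above: "\<And>p q r. \<lbrakk>p \<in> P; q \<in> P; r \<in> P\<rbrakk> \<Longrightarrow> \<exists>\<eta>\<in>partial_condensations P R.
      dom \<eta> = closed_interval R p q \<and> ran \<eta> \<subseteq> above R r"
begin

abbreviation le (infix "\<sqsubseteq>" 50)
  where "x \<sqsubseteq> y \<equiv> (x, y) \<in> R"

lemma le_refl: "x \<in> P \<Longrightarrow> x \<sqsubseteq> x"
  using po by (simp add: partial_order_on_def preorder_on_def refl_on_def)

lemma le_trans: "\<lbrakk>x \<sqsubseteq> y; y \<sqsubseteq> z\<rbrakk> \<Longrightarrow> x \<sqsubseteq> z"
  using po by (auto simp: partial_order_on_def preorder_on_def dest: transD)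

lemma le_antisym: "\<lbrakk>x \<sqsubseteq> y; y \<sqsubseteq> x\<rbrakk> \<Longrightarrow> x = y"
  using po by (auto simp: partial_order_on_def dest: antisymD)

lemma le_carrier: assumes "x \<sqsubseteq> y" shows "x \<in> P" "y \<in> P"
  using po assms by (auto simp: partial_order_on_def preorder_on_def refl_on_def)

lemma infinite_P: "infinite P"
  using ordLeq_ordIso_trans[OF natLeq_kappa ordIso_symmetric[OF card_P]]
    infinite_iff_natLeq_ordLeq by blast

lemma finite_ordLess_kappa: "finite S \<Longrightarrow> |S| <o \<kappa>"
  unfolding finite_iff_ordLess_natLeq by (rule ordLess_ordLeq_trans[OF _ natLeq_kappa])

text \<open>The rule for unions compares with the size of an infinite set, so the argument passes
  from \<kappa> to \<open>|P|\<close> and back.\<close>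

lemma insert_ordLess_kappa:
  assumes "|S| <o \<kappa>" shows "|insert x S| <o \<kappa>"
proof -
  have "|S| <o |P|" "|{x}| <o |P|"
    using assms finite_ordLess_kappa[of "{x}"] ordLess_ordIso_trans[OF _ ordIso_symmetric[OF card_P]] by auto
  then have "|{x} \<union> S| <o |P|"
    by (intro card_of_Un_ordLess_infinite infinite_P)
  then show ?thesis
    using ordLess_ordIso_trans[OF _ card_P] by simp
qed

lemma upper_bound:
  "\<lbrakk>S \<subseteq> P; |S| <o \<kappa>\<rbrakk> \<Longrightarrow> \<exists>u\<in>P. \<forall>s\<in>S. s \<sqsubseteq> u"
  using up_directed by (simp add: upwards_directed_def)

lemma lower_bound:
  "\<lbrakk>S \<subseteq> P; |S| <o \<kappa>\<rbrakk> \<Longrightarrow> \<exists>l\<in>P. \<forall>s\<in>S. l \<sqsubseteq> s"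
  using down_directed by (simp add: downwards_directed_def)

section \<open>Sets bounded on both sides\<close>

text \<open>Since \<open>R\<close> is a relation on \<open>P\<close>, the bounds also force
  \<open>S\<close> to lie inside \<open>P\<close>.\<close>

definition order_bounded :: "'a set \<Rightarrow> bool"
  where "order_bounded S \<longleftrightarrow> (\<exists>l\<in>P. \<exists>u\<in>P. \<forall>s\<in>S. l \<sqsubseteq> s \<and> s \<sqsubseteq> u)"

text \<open>The chosen bounds \<open>l i\<close> and \<open>u i\<close> form two sets of size below
  \<kappa>, which directedness bounds in turn. Only the number of sets is restricted, not the size
  of each \<open>S i\<close>.\<close>

lemma order_bounded_Union:
  assumes "|I| <o \<kappa>" "\<And>i. i \<in> I \<Longrightarrow> order_bounded (S i)"
  shows "order_bounded (\<Union>i\<in>I. S i)"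
proof -
  obtain l u where lu: "\<And>i. i \<in> I \<Longrightarrow> l i \<in> P \<and> u i \<in> P \<and> (\<forall>s\<in>S i. l i \<sqsubseteq> s \<and> s \<sqsubseteq> u i)"
    using assms(2) unfolding order_bounded_def by metis
  have card: "|l ` I| <o \<kappa>" "|u ` I| <o \<kappa>"
    by (rule ordLeq_ordLess_trans[OF card_of_image assms(1)])+
  obtain l' where l': "l' \<in> P" "\<And>i. i \<in> I \<Longrightarrow> l' \<sqsubseteq> l i"
    using lower_bound[OF _ card(1)] lu by blast
  obtain u' where u': "u' \<in> P" "\<And>i. i \<in> I \<Longrightarrow> u i \<sqsubseteq> u'"
    using upper_bound[OF _ card(2)] lu by blast
  have "l' \<sqsubseteq> s \<and> s \<sqsubseteq> u'" if "i \<in> I" "s \<in> S i" for i s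
    using that l' u' lu le_trans by meson
  with l'(1) u'(1) show ?thesis
    unfolding order_bounded_def by blast
qed

lemma order_bounded_insert:
  assumes "order_bounded S" "x \<in> P"
  shows "order_bounded (insert x S)"
proof -
  have "order_bounded {x}"
    using assms(2) le_refl unfolding order_bounded_def by blast
  then have "order_bounded (\<Union>A\<in>{{x}, S}. A)"
    using assms(1) by (intro order_bounded_Union finite_ordLess_kappa) auto
  then show ?thesis
    by simp
qed

lemma order_boundedE:
  assumes "order_bounded S" "x \<in> P"
  obtains l u where "l \<in> P" "u \<in> P" "l \<sqsubseteq> x" "x \<sqsubseteq> u" "\<And>s. s \<in> S \<Longrightarrow> l \<sqsubseteq> s \<and> s \<sqsubseteq> u"
  using order_bounded_insert[OF assms] unfolding order_bounded_def by blast

section \<open>Strict comparabilities\<close>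

text \<open>A common upper bound of two distinct points differs from at least one of them.\<close>

lemma not_antichain: obtains p q where "p \<sqsubseteq> q" "p \<noteq> q"
proof -
  obtain p where p: "p \<in> P"
    using infinite_P by fastforce
  obtain q where q: "q \<in> P" "q \<noteq> p"
    using infinite_P by (metis finite.emptyI finite_insert finite_subset insertCI subsetI)
  obtain u where "p \<sqsubseteq> u" "q \<sqsubseteq> u"
    using upper_bound[of "{p, q}"] p q(1) finite_ordLess_kappa[of "{p, q}"] by auto
  with q that show thesis
    by blast
qed

text \<open>Directedness gives only weak bounds. Hypothesis (ii) gives strict ones: an interval with
  distinct endpoints maps injectively below \<open>r\<close>, and the images of the endpoints cannot
  both be \<open>r\<close>.\<close>

lemma ex_strictly_below:
  assumes "r \<in> P" obtains s where "s \<sqsubseteq> r" "s \<noteq> r"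
proof -
  obtain p q where pq: "p \<sqsubseteq> q" "p \<noteq> q"
    by (rule not_antichain)
  obtain \<eta> where \<eta>: "\<eta> \<in> partial_condensations P R" "dom \<eta> = closed_interval R p q" "ran \<eta> \<subseteq> under R r"
    using into_under pq(1) assms le_carrier by meson
  have "p \<in> dom \<eta>" "q \<in> dom \<eta>"
    using \<eta>(2) pq le_refl le_carrier by (auto simp: closed_interval_def)
  then obtain x y where xy: "\<eta> p = Some x" "\<eta> q = Some y"
    by blast
  have "inj_on \<eta> (dom \<eta>)"
    using \<eta>(1) by (simp add: partial_condensations_def)
  then have "x \<noteq> y"
    using xy pq(2) inj_onD[of \<eta> "dom \<eta>" p q] by auto
  moreover have "x \<sqsubseteq> r" "y \<sqsubseteq> r"
    using subsetD[OF \<eta>(3) ranI] xy by (simp_all add: under_def)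
  ultimately show thesis
    using that by metis
qed

text \<open>Dual argument, with (iii) in place of (ii).\<close>

lemma ex_strictly_above:
  assumes "r \<in> P" obtains s where "r \<sqsubseteq> s" "s \<noteq> r"
proof -
  obtain p q where pq: "p \<sqsubseteq> q" "p \<noteq> q"
    by (rule not_antichain)
  obtain \<eta> where \<eta>: "\<eta> \<in> partial_condensations P R" "dom \<eta> = closed_interval R p q" "ran \<eta> \<subseteq> above R r"
    using into_above pq(1) assms le_carrier by meson
  have "p \<in> dom \<eta>" "q \<in> dom \<eta>"
    using \<eta>(2) pq le_refl le_carrier by (auto simp: closed_interval_def)
  then obtain x y where xy: "\<eta> p = Some x" "\<eta> q = Some y"
    by blast
  have "inj_on \<eta> (dom \<eta>)"
    using \<eta>(1) by (simp add: partial_condensations_def)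
  then have "x \<noteq> y"
    using xy pq(2) inj_onD[of \<eta> "dom \<eta>" p q] by auto
  moreover have "r \<sqsubseteq> x" "r \<sqsubseteq> y"
    using subsetD[OF \<eta>(3) ranI] xy by (simp_all add: above_def)
  ultimately show thesis
    using that by metis
qed

section \<open>Condensation graphs and their unions\<close>

text \<open>Condensations are represented by their graphs, so that limits are unions.\<close>

definition condensation :: "'a rel \<Rightarrow> bool"
  where "condensation G \<longleftrightarrow> G \<subseteq> P \<times> P \<and>
    (\<forall>x x' y y'. (x, x') \<in> G \<longrightarrow> (y, y') \<in> G \<longrightarrow> (x = y \<longleftrightarrow> x' = y') \<and> (x \<sqsubseteq> y \<longrightarrow> x' \<sqsubseteq> y'))"

text \<open>Convexity is asked of the domain only; the range just has to leave room strictly below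
  and strictly above it.\<close>

definition convex_bounded :: "'a rel \<Rightarrow> bool"
  where "convex_bounded G \<longleftrightarrow> order_bounded (Domain G) \<and> order_bounded (Range G) \<and>
    (\<forall>x\<in>Domain G. \<forall>y\<in>Domain G. \<forall>z. x \<sqsubseteq> z \<longrightarrow> z \<sqsubseteq> y \<longrightarrow> z \<in> Domain G)"

definition extensible :: "'a rel \<Rightarrow> bool"
  where "extensible G \<longleftrightarrow> condensation G \<and> convex_bounded G"

text \<open>The equivalence \<open>x = y \<longleftrightarrow> x' = y'\<close> says from left to
  right that the graph is single-valued, and from right to left that it is injective.\<close>

lemma condensationI:
  assumes "\<And>x x'. (x, x') \<in> G \<Longrightarrow> x \<in> P \<and> x' \<in> P"
    and "\<And>x x' y y'. \<lbrakk>(x, x') \<in> G; (y, y') \<in> G\<rbrakk> \<Longrightarrow> (x = y \<longleftrightarrow> x' = y') \<and> (x \<sqsubseteq> y \<longrightarrow> x' \<sqsubseteq> y')"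
  shows "condensation G"
  using assms unfolding condensation_def by auto

lemma condensationD:
  assumes "condensation G" "(x, x') \<in> G"
  shows "x \<in> P" "x' \<in> P"
    and "(y, y') \<in> G \<Longrightarrow> x = y \<longleftrightarrow> x' = y'"
    and "\<lbrakk>(y, y') \<in> G; x \<sqsubseteq> y\<rbrakk> \<Longrightarrow> x' \<sqsubseteq> y'"
  using assms unfolding condensation_def by blast+

lemma condensation_subset: "\<lbrakk>condensation G; H \<subseteq> G\<rbrakk> \<Longrightarrow> condensation H"
  unfolding condensation_def by blast

text \<open>No point of \<open>H\<close> is below a point of \<open>G\<close>, so the only mixed
  comparisons run from \<open>G\<close> to \<open>H\<close>, and these are respected because every
  value of \<open>G\<close> is below every value of \<open>H\<close>. By reflexivity the domains are
  disjoint as well.\<close>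

lemma condensation_Un:
  assumes G: "condensation G" and H: "condensation H"
    and GH: "\<And>x x' y y'. \<lbrakk>(x, x') \<in> G; (y, y') \<in> H\<rbrakk> \<Longrightarrow> \<not> y \<sqsubseteq> x \<and> x' \<sqsubseteq> y' \<and> x' \<noteq> y'"
  shows "condensation (G \<union> H)"
proof (rule condensationI)
  show "x \<in> P \<and> x' \<in> P" if "(x, x') \<in> G \<union> H" for x x'
    using that condensationD(1,2)[OF G] condensationD(1,2)[OF H] by blast
  show "(x = y \<longleftrightarrow> x' = y') \<and> (x \<sqsubseteq> y \<longrightarrow> x' \<sqsubseteq> y')"
    if xy: "(x, x') \<in> G \<union> H" "(y, y') \<in> G \<union> H" for x x' y y'
  proof -
    consider "(x, x') \<in> G" "(y, y') \<in> G" | "(x, x') \<in> H" "(y, y') \<in> H"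
      | "(x, x') \<in> G" "(y, y') \<in> H" | "(x, x') \<in> H" "(y, y') \<in> G"
      using xy by blast
    then show ?thesis
    proof cases
      case 1
      then show ?thesis using condensationD(3,4)[OF G] by blast
    next
      case 2
      then show ?thesis using condensationD(3,4)[OF H] by blast
    next
      case 3
      then show ?thesis using GH[OF 3] condensationD(1)[OF G] le_refl by blast
    next
      case 4
      then show ?thesis using GH[OF 4(2,1)] condensationD(1)[OF G] le_refl by blast
    qed
  qed
qed

lemma partial_condensation_graph:
  assumes "\<eta> \<in> partial_condensations P R"
  shows "condensation {(x, y). \<eta> x = Some y}"
proof (rule condensationI; clarsimp)
  fix x x' assume "\<eta> x = Some x'"
  then show "x \<in> P \<and> x' \<in> P"
    using assms by (auto simp: partial_condensations_def dom_def ran_def)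
next
  fix x x' y y' assume "\<eta> x = Some x'" "\<eta> y = Some y'"
  then show "(x = y) = (x' = y') \<and> (x \<sqsubseteq> y \<longrightarrow> x' \<sqsubseteq> y')"
    using assms
    by (smt (verit, best) domI inj_onD mem_Collect_eq option.sel partial_condensations_def)
qed

text \<open>Separate from the bounded version below because the union of all stages has domain and
  range \<open>P\<close>, which has no bounds.\<close>

lemma condensation_chain_Union:
  assumes "\<And>G. G \<in> \<G> \<Longrightarrow> condensation G"
    and "\<And>G H. \<lbrakk>G \<in> \<G>; H \<in> \<G>\<rbrakk> \<Longrightarrow> G \<subseteq> H \<or> H \<subseteq> G"
  shows "condensation (\<Union>\<G>)"
proof (rule condensationI)
  fix x x' assume "(x, x') \<in> \<Union>\<G>"
  then show "x \<in> P \<and> x' \<in> P"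
    using assms(1) condensationD(1,2) by (meson UnionE)
next
  fix x x' y y' assume "(x, x') \<in> \<Union>\<G>" "(y, y') \<in> \<Union>\<G>"
  then obtain G where "G \<in> \<G>" "(x, x') \<in> G" "(y, y') \<in> G"
    using assms(2) by blast
  then show "(x = y \<longleftrightarrow> x' = y') \<and> (x \<sqsubseteq> y \<longrightarrow> x' \<sqsubseteq> y')"
    using assms(1) condensationD(3,4) by blast
qed

text \<open>The size of the family enters through the bounds. Convexity passes to the union because
  any two points of its domain already lie in the domain of one member.\<close>

lemma extensible_chain_Union:
  assumes ext: "\<And>G. G \<in> \<G> \<Longrightarrow> extensible G"
    and chain: "\<And>G H. \<lbrakk>G \<in> \<G>; H \<in> \<G>\<rbrakk> \<Longrightarrow> G \<subseteq> H \<or> H \<subseteq> G"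
    and card: "|\<G>| <o \<kappa>"
  shows "extensible (\<Union>\<G>)"
proof -
  have "order_bounded (Domain (\<Union>\<G>))" "order_bounded (Range (\<Union>\<G>))"
    unfolding Domain_Union Range_Union
    using ext by (auto intro!: order_bounded_Union[OF card] simp: extensible_def convex_bounded_def)
  moreover have "z \<in> Domain (\<Union>\<G>)"
    if xy: "x \<in> Domain (\<Union>\<G>)" "y \<in> Domain (\<Union>\<G>)" and z: "x \<sqsubseteq> z" "z \<sqsubseteq> y" for x y z
  proof -
    obtain G where "G \<in> \<G>" "x \<in> Domain G" "y \<in> Domain G"
      using xy chain by blast
    then show ?thesis
      using z ext unfolding extensible_def convex_bounded_def by blast
  qed
  ultimately show ?thesis
    using condensation_chain_Union[of \<G>] ext chain
    unfolding extensible_def convex_bounded_def by blast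
qed

lemma extensible_empty: "extensible {}"
  using extensible_chain_Union[of "{}"] finite_ordLess_kappa[of "{}"] by simp

section \<open>One-step extensions\<close>

lemma extensible_insert:
  assumes G: "extensible G" and aP: "a \<in> P" and yP: "y \<in> P"
    and y: "y \<notin> Range G" and a: "incomparable_to_set R a (Domain G)"
  shows "extensible (insert (a, y) G)"
proof -
  have a: "\<not> a \<sqsubseteq> d" "\<not> d \<sqsubseteq> a" if "d \<in> Domain G" for d
    using a that unfolding incomparable_to_set_def by auto
  have aG: "a \<notin> Domain G"
    using a aP le_refl by blast
  have "condensation (insert (a, y) G)"
  proof (rule condensationI)
    show "u \<in> P \<and> u' \<in> P" if "(u, u') \<in> insert (a, y) G" for u u'
      using that G aP yP condensationD(1,2) unfolding extensible_def by blast
    show "(u = v \<longleftrightarrow> u' = v') \<and> (u \<sqsubseteq> v \<longrightarrow> u' \<sqsubseteq> v')"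
      if "(u, u') \<in> insert (a, y) G" "(v, v') \<in> insert (a, y) G" for u u' v v'
    proof (cases "(u, u') \<in> G \<and> (v, v') \<in> G")
      case True
      then show ?thesis
        using G condensationD(3,4) unfolding extensible_def by blast
    next
      case False
      then show ?thesis
        using that y a aG yP le_refl by (metis DomainI RangeI insertE prod.inject)
    qed
  qed
  moreover have "order_bounded (Domain (insert (a, y) G))" "order_bounded (Range (insert (a, y) G))"
    using G aP yP order_bounded_insert unfolding extensible_def convex_bounded_def by simp_all
  moreover have "z \<in> Domain (insert (a, y) G)"
    if uv: "u \<in> Domain (insert (a, y) G)" "v \<in> Domain (insert (a, y) G)"
      and z: "u \<sqsubseteq> z" "z \<sqsubseteq> v" for u v z
  proof -
    \<comment> \<open>Comparable endpoints are both old or both equal to \<open>a\<close>, so the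
      only interval with endpoint \<open>a\<close> to be checked is the trivial one.\<close>
    have "u \<sqsubseteq> v"
      using z le_trans by blast
    then consider "u = a" "v = a" | "u \<in> Domain G" "v \<in> Domain G"
      using uv a by auto
    then show ?thesis
      using z G le_antisym unfolding extensible_def convex_bounded_def by cases blast+
  qed
  ultimately show ?thesis
    unfolding extensible_def convex_bounded_def by blast
qed

lemma extend_range:
  assumes G: "extensible G" and y: "y \<in> P"
  obtains G' where "extensible G'" "G \<subseteq> G'" "y \<in> Range G'"
proof (cases "y \<in> Range G")
  case True
  with that G show thesis by blast
next
  case False
  \<comment> \<open>Enclosing \<open>y\<close> along with the domain ensures
    \<open>p \<sqsubseteq> q\<close>, as (i) demands, even if \<open>G\<close> is empty.\<close>
  obtain p q where pq: "p \<in> P" "q \<in> P" "p \<sqsubseteq> y" "y \<sqsubseteq> q" "\<And>x. x \<in> Domain G \<Longrightarrow> p \<sqsubseteq> x \<and> x \<sqsubseteq> q"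
    using G y order_boundedE unfolding extensible_def convex_bounded_def by metis
  obtain a where a: "a \<in> P" "incomparable_to_set R a (closed_interval R p q)"
    using ex_incomparable pq(1-4) le_trans by meson
  then have "incomparable_to_set R a (Domain G)"
    using pq(5) by (auto simp: incomparable_to_set_def closed_interval_def)
  then have "extensible (insert (a, y) G)"
    using extensible_insert G a(1) y False by blast
  with that show thesis
    by blast
qed

text \<open>The domain grows to a whole interval \<open>I\<close> to remain convex. The new graph is
  glued from three layers, over \<open>L\<close>, the old domain and \<open>U\<close>, whose values
  are stacked in this order.\<close>

lemma extend_domain:
  assumes G: "extensible G" and x: "x \<in> P"
  obtains G' where "extensible G'" "G \<subseteq> G'" "x \<in> Domain G'"
proof -
  let ?D = "Domain G"
  have cG: "condensation G"
    using G unfolding extensible_def by blast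
  have convex: "z \<in> ?D" if "u \<in> ?D" "v \<in> ?D" "u \<sqsubseteq> z" "z \<sqsubseteq> v" for u v z
    using G that unfolding extensible_def convex_bounded_def by blast
  obtain p q where pq: "p \<in> P" "q \<in> P" "p \<sqsubseteq> x" "x \<sqsubseteq> q" "\<And>x. x \<in> ?D \<Longrightarrow> p \<sqsubseteq> x \<and> x \<sqsubseteq> q"
    using G x order_boundedE unfolding extensible_def convex_bounded_def by metis
  \<comment> \<open>Here \<open>x\<close> is enclosed with the range to get
    \<open>s \<sqsubseteq> t\<close> even if \<open>G\<close> is empty.\<close>
  obtain s t where st: "s \<in> P" "t \<in> P" "s \<sqsubseteq> x" "x \<sqsubseteq> t" "\<And>y. y \<in> Range G \<Longrightarrow> s \<sqsubseteq> y \<and> y \<sqsubseteq> t"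
    using G x order_boundedE unfolding extensible_def convex_bounded_def by metis
  \<comment> \<open>Strictness of \<open>s'\<close> and \<open>t'\<close> keeps the values of
    different layers distinct.\<close>
  obtain s' where s': "s' \<sqsubseteq> s" "s' \<noteq> s"
    using ex_strictly_below st(1) by blast
  obtain t' where t': "t \<sqsubseteq> t'" "t' \<noteq> t"
    using ex_strictly_above st(2) by blast
  define I where "I = closed_interval R p q"
  have DI: "?D \<subseteq> I" and xI: "x \<in> I" and pI: "p \<in> I" and qI: "q \<in> I"
    using pq le_refl le_trans unfolding I_def closed_interval_def by blast+
  have pqI: "p \<sqsubseteq> z" "z \<sqsubseteq> q" if "z \<in> I" for z
    using that by (auto simp: I_def closed_interval_def)
  obtain \<eta>1 where \<eta>1: "\<eta>1 \<in> partial_condensations P R" "dom \<eta>1 = I" "ran \<eta>1 \<subseteq> under R s'"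
    using into_under[OF pq(1,2)] s' le_carrier unfolding I_def by blast
  obtain \<eta>2 where \<eta>2: "\<eta>2 \<in> partial_condensations P R" "dom \<eta>2 = I" "ran \<eta>2 \<subseteq> above R t'"
    using into_above[OF pq(1,2)] t' le_carrier unfolding I_def by blast
  define E1 where "E1 = {(z, w). \<eta>1 z = Some w}"
  define E2 where "E2 = {(z, w). \<eta>2 z = Some w}"
  have E: "condensation E1" "condensation E2" "Domain E1 = I" "Domain E2 = I"
    using partial_condensation_graph \<eta>1(1,2) \<eta>2(1,2) unfolding E1_def E2_def by auto
  have E1: "w \<sqsubseteq> s'" if "(z, w) \<in> E1" for z w
    using that \<eta>1(3) by (auto simp: E1_def ran_def under_def)
  have E2: "t' \<sqsubseteq> w" if "(z, w) \<in> E2" for z w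
    using that \<eta>2(3) by (auto simp: E2_def ran_def above_def)
  \<comment> \<open>Points incomparable to the whole old domain go to \<open>U\<close>, together
    with those above an old point.\<close>
  define L where "L = {z \<in> I - ?D. \<exists>d\<in>?D. z \<sqsubseteq> d}"
  define U where "U = I - ?D - L"
  define G' where "G' = {(z, w) \<in> E1. z \<in> L} \<union> G \<union> {(z, w) \<in> E2. z \<in> U}"
  have st': "s' \<sqsubseteq> t" "s' \<sqsubseteq> t'"
    using st s' t' le_trans by blast+
  have strict: "\<not> s \<sqsubseteq> s'" "\<not> t' \<sqsubseteq> t"
    using s' t' le_antisym by blast+
  \<comment> \<open>An old point below a point of \<open>L\<close> would enclose it between two old
    points, against convexity. A point of \<open>U\<close> below an old point or below a point of
    \<open>L\<close> would itself belong to \<open>L\<close>.\<close>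
  have up: "\<not> u \<sqsubseteq> v" if "u \<in> ?D \<and> v \<in> L \<or> u \<in> U \<and> v \<in> ?D \<or> u \<in> U \<and> v \<in> L" for u v
    using that convex le_trans unfolding L_def U_def by blast
  have "condensation ({(z, w) \<in> E1. z \<in> L} \<union> G)"
  proof (rule condensation_Un)
    show "condensation {(z, w) \<in> E1. z \<in> L}"
      using E(1) by (rule condensation_subset) blast
    show "\<not> v \<sqsubseteq> u \<and> u' \<sqsubseteq> v' \<and> u' \<noteq> v'"
      if u: "(u, u') \<in> {(z, w) \<in> E1. z \<in> L}" and v: "(v, v') \<in> G" for u u' v v'
    proof -
      have "u' \<sqsubseteq> s'" "s \<sqsubseteq> v'"
        using u v E1 st(5) by blast+
      moreover from this have "u' \<sqsubseteq> v'"
        using s'(1) le_trans by blast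
      ultimately show ?thesis
        using u v up[of v u] strict le_trans by blast
    qed
  qed (rule cG)
  then have "condensation G'"
    unfolding G'_def
  proof (rule condensation_Un)
    show "condensation {(z, w) \<in> E2. z \<in> U}"
      using E(2) by (rule condensation_subset) blast
    show "\<not> v \<sqsubseteq> u \<and> u' \<sqsubseteq> v' \<and> u' \<noteq> v'"
      if u: "(u, u') \<in> {(z, w) \<in> E1. z \<in> L} \<union> G" and v: "(v, v') \<in> {(z, w) \<in> E2. z \<in> U}" for u u' v v'
    proof -
      \<comment> \<open>The bound \<open>t\<close> lies above the values of both lower layers, since
        \<open>s' \<sqsubseteq> t\<close>.\<close>
      have "u' \<sqsubseteq> t" "t' \<sqsubseteq> v'"
        using u v E1 E2 st(5) le_trans[OF _ st'(1)] by blast+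
      moreover from this have "u' \<sqsubseteq> v'"
        using t'(1) le_trans by blast
      ultimately show ?thesis
        using u v up[of v u] strict le_trans by blast
    qed
  qed
  moreover have dom: "Domain G' = I"
  proof
    show "Domain G' \<subseteq> I"
      using DI unfolding G'_def U_def L_def by (auto dest: DomainI)
    show "I \<subseteq> Domain G'"
    proof
      fix z assume "z \<in> I"
      then obtain v w where "(z, v) \<in> E1" "(z, w) \<in> E2"
        using E(3,4) by blast
      then show "z \<in> Domain G'"
        using \<open>z \<in> I\<close> unfolding G'_def U_def by blast
    qed
  qed
  moreover have "order_bounded I"
    using pq(1,2) pqI unfolding order_bounded_def by blast
  moreover have "order_bounded (Range G')"
  proof -
    \<comment> \<open>Since \<open>p\<close> is least and \<open>q\<close> greatest in
      \<open>I\<close>, monotonicity puts \<open>l\<close> below all values of \<open>E1\<close> and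
      \<open>h\<close> above all values of \<open>E2\<close>, whichever layers \<open>p\<close> and
      \<open>q\<close> belong to.\<close>
    obtain l where l: "(p, l) \<in> E1"
      using E(3) pI by blast
    obtain h where h: "(q, h) \<in> E2"
      using E(4) qI by blast
    have lh: "l \<sqsubseteq> s'" "t' \<sqsubseteq> h"
      using E1 E2 l h by auto
    have chain: "l \<sqsubseteq> s" "l \<sqsubseteq> t'" "s' \<sqsubseteq> h" "t \<sqsubseteq> h"
      using lh st' s'(1) t'(1) le_trans by blast+
    have "l \<sqsubseteq> w \<and> w \<sqsubseteq> h" if zw: "(z, w) \<in> G'" for z w
    proof -
      have z: "p \<sqsubseteq> z" "z \<sqsubseteq> q"
        using zw dom pqI by blast+
      consider "(z, w) \<in> E1" | "(z, w) \<in> E2" | "(z, w) \<in> G"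
        using zw unfolding G'_def by blast
      then show ?thesis
      proof cases
        case 1
        then show ?thesis
          using condensationD(4)[OF E(1) l _ z(1)] E1 chain le_trans by blast
      next
        case 2
        then show ?thesis
          using condensationD(4)[OF E(2) _ h z(2)] E2 chain le_trans by blast
      next
        case 3
        then show ?thesis
          using st(5) chain le_trans by blast
      qed
    qed
    moreover have "l \<in> P" "h \<in> P"
      using lh le_carrier by blast+
    ultimately show ?thesis
      unfolding order_bounded_def by blast
  qed
  moreover have "z \<in> I" if "u \<in> I" "v \<in> I" "u \<sqsubseteq> z" "z \<sqsubseteq> v" for u v z
    using that le_trans unfolding I_def closed_interval_def by blast
  ultimately have "extensible G'"
    unfolding extensible_def convex_bounded_def by blast
  moreover have "G \<subseteq> G'" "x \<in> Domain G'"
    using xI dom unfolding G'_def by blast+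
  ultimately show thesis
    using that by blast
qed

lemma extend_both:
  assumes "extensible G" "x \<in> P"
  obtains G' where "extensible G'" "G \<subseteq> G'" "x \<in> Domain G'" "x \<in> Range G'"
proof -
  obtain H where H: "extensible H" "G \<subseteq> H" "x \<in> Domain H"
    using extend_domain assms by blast
  obtain G' where "extensible G'" "H \<subseteq> G'" "x \<in> Range G'"
    using extend_range H(1) assms(2) by blast
  with H that show thesis
    by blast
qed

section \<open>Transfinite back-and-forth recursion\<close>

text \<open>The recursion runs along the cardinal well-order \<open>|P|\<close> of \<open>P\<close>
  itself: stage \<open>x\<close> takes care of the point \<open>x\<close>, and fewer than \<kappa>
  stages precede it.\<close>

lemma extend_to_bijection:
  assumes G0: "extensible G0"
  obtains B where "condensation B" "G0 \<subseteq> B" "Domain B = P" "Range B = P"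
proof -
  define step where "step x G = (SOME G'. extensible G' \<and> G \<subseteq> G' \<and> x \<in> Domain G' \<and> x \<in> Range G')" for x G
  have step: "extensible (step x G)" "G \<subseteq> step x G" "x \<in> Domain (step x G)" "x \<in> Range (step x G)"
    if G: "extensible G" "x \<in> P" for x G
  proof -
    have "\<exists>G'. extensible G' \<and> G \<subseteq> G' \<and> x \<in> Domain G' \<and> x \<in> Range G'"
      by (rule extend_both[OF G]) blast
    from someI_ex[OF this]
    show "extensible (step x G)" "G \<subseteq> step x G" "x \<in> Domain (step x G)" "x \<in> Range (step x G)"
      unfolding step_def by simp_all
  qed
  have wo: "Well_order |P|" and wf: "wf ( |P| - Id)"
    using card_of_Well_order[of P] by (simp_all add: well_order_on_def)
  define below where "below x = underS |P| x" for x
  \<comment> \<open>\<open>G0\<close> is joined in at every stage, so the least element, which has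
    no predecessors, starts from it too.\<close>
  define F where "F = wfrec ( |P| - Id) (\<lambda>h x. step x (G0 \<union> (\<Union>y\<in>below x. h y)))"
  have below_iff: "y \<in> below x \<longleftrightarrow> (y, x) \<in> |P| - Id" for x y
    by (auto simp: below_def underS_def)
  have F: "F x = step x (\<Union>(insert G0 (F ` below x)))" for x
  proof -
    \<comment> \<open>\<open>wfrec\<close> passes a restricted copy of \<open>F\<close>, which
      agrees with \<open>F\<close> on all predecessors of \<open>x\<close>.\<close>
    have "(\<Union>y\<in>below x. cut F ( |P| - Id) x y) = (\<Union>y\<in>below x. F y)"
      by (intro SUP_cong refl) (simp add: cut_def below_iff)
    then show ?thesis
      using def_wfrec[OF eq_reflection[OF F_def] wf, of x] by simp
  qed
  have total: "y \<in> below x \<or> x \<in> below y \<or> x = y" if "x \<in> P" "y \<in> P" for x y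
    using that wo_rel.TOTALS[OF wo_rel.intro[OF wo]] by (auto simp: below_iff Field_card_of)
  have below_P: "y \<in> P" if "y \<in> below x" for x y
    using that FieldI1[of y x "|P|"] by (simp add: below_iff Field_card_of)
  \<comment> \<open>The inclusions between stages belong to the induction claim because they make
    the earlier stages a chain, whose union is then extensible.\<close>
  have main: "extensible (F x) \<and> G0 \<subseteq> F x \<and> (\<forall>y\<in>below x. F y \<subseteq> F x) \<and> x \<in> Domain (F x) \<and> x \<in> Range (F x)"
    if "x \<in> P" for x
    using wf that
  proof (induction x rule: wf_induct_rule)
    case (less x)
    have IH: "extensible (F y)" "G0 \<subseteq> F y" "\<And>z. z \<in> below y \<Longrightarrow> F z \<subseteq> F y" if "y \<in> below x" for y
      using less.IH[of y] that below_P by (auto simp: below_iff)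
    have "|below x| <o |P|"
      using less.prems card_of_underS[OF card_of_Card_order, of x P] by (simp add: below_def Field_card_of)
    then have "|F ` below x| <o \<kappa>"
      by (rule ordLess_ordIso_trans[OF ordLeq_ordLess_trans[OF card_of_image] card_P])
    then have "|insert G0 (F ` below x)| <o \<kappa>"
      by (rule insert_ordLess_kappa)
    moreover have "F y \<subseteq> F z \<or> F z \<subseteq> F y" if "y \<in> below x" "z \<in> below x" for y z
      using that total[of y z] below_P IH(3) by blast
    then have "G \<subseteq> H \<or> H \<subseteq> G" if "G \<in> insert G0 (F ` below x)" "H \<in> insert G0 (F ` below x)" for G H
      using that IH(2) by (elim insertE imageE) simp_all
    ultimately have ext: "extensible (\<Union>(insert G0 (F ` below x)))"
      using IH(1) G0 by (intro extensible_chain_Union) auto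
    have "\<Union>(insert G0 (F ` below x)) \<subseteq> F x"
      unfolding F[of x] by (rule step(2)[OF ext less.prems])
    then have "G0 \<subseteq> F x" "\<forall>y\<in>below x. F y \<subseteq> F x"
      by auto
    moreover have "extensible (F x)" "x \<in> Domain (F x)" "x \<in> Range (F x)"
      unfolding F[of x] by (rule step[OF ext less.prems])+
    ultimately show ?case
      by blast
  qed
  define B where "B = \<Union>(F ` P)"
  have "F y \<subseteq> F z \<or> F z \<subseteq> F y" if "y \<in> P" "z \<in> P" for y z
    using total[OF that] main that by blast
  then have "G \<subseteq> H \<or> H \<subseteq> G" if "G \<in> F ` P" "H \<in> F ` P" for G H
    using that by (elim imageE) simp
  then have cB: "condensation B"
    unfolding B_def using main by (intro condensation_chain_Union) (auto simp: extensible_def)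
  have FB: "F x \<subseteq> B" if "x \<in> P" for x
    using that unfolding B_def by blast
  obtain p where "p \<in> P"
    using infinite_imp_nonempty[OF infinite_P] by blast
  then have "G0 \<subseteq> B"
    using main[of p] FB[of p] by blast
  moreover have "P \<subseteq> Domain B"
    using main FB Domain_mono by (meson subsetD subsetI)
  moreover have "P \<subseteq> Range B"
    using main FB Range_mono by (meson subsetD subsetI)
  moreover have "Domain B \<subseteq> P" "Range B \<subseteq> P"
    using cB unfolding condensation_def by blast+
  ultimately show thesis
    using that[OF cB] by blast
qed

section \<open>A bijective condensation that is not an automorphism\<close>

lemma not_reversible: "\<not> reversible P R"
proof
  assume rev: "reversible P R"
  obtain p where p: "p \<in> P"
    using infinite_P by fastforce
  \<comment> \<open>The degenerate interval from \<open>p\<close> to \<open>p\<close> turns (i) into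
    a point incomparable to \<open>p\<close>.\<close>
  obtain a where a: "a \<in> P" "incomparable_to_set R a (closed_interval R p p)"
    using ex_incomparable p le_refl by blast
  have pa: "\<not> a \<sqsubseteq> p" "\<not> p \<sqsubseteq> a"
    using a(2) p le_refl by (auto simp: incomparable_to_set_def closed_interval_def)
  obtain t where t: "p \<sqsubseteq> t" "t \<noteq> p"
    using ex_strictly_above p by blast
  have "extensible {(p, p)}"
    using extensible_insert[OF extensible_empty p p] by (simp add: incomparable_to_set_def)
  then have "extensible (insert (a, t) {(p, p)})"
    using extensible_insert a(1) t le_carrier pa by (auto simp: incomparable_to_set_def)
  then obtain B where B: "condensation B" "insert (a, t) {(p, p)} \<subseteq> B" "Domain B = P" "Range B = P"
    by (rule extend_to_bijection)
  obtain f where f: "\<And>x. x \<in> P \<Longrightarrow> (x, f x) \<in> B"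
    using bchoice[of P "\<lambda>x y. (x, y) \<in> B"] B(3) by blast
  have f_eq: "f x = y" if "(x, y) \<in> B" for x y
    using that f condensationD(1,3)[OF B(1)] by blast
  have "inj_on f P"
    using f condensationD(3)[OF B(1)] by (metis inj_onI)
  moreover have "f ` P = P"
  proof -
    have "f ` P \<subseteq> P"
      using f B(4) by blast
    moreover have "P \<subseteq> f ` P"
      using B(3,4) f_eq by (metis DomainI RangeE image_eqI subsetI)
    ultimately show ?thesis
      by blast
  qed
  moreover have "\<forall>x\<in>P. \<forall>y\<in>P. x \<sqsubseteq> y \<longrightarrow> f x \<sqsubseteq> f y"
    using f condensationD(4)[OF B(1)] by blast
  ultimately have "poset_automorphism P R f"
    using rev by (simp add: reversible_def bij_betw_def)
  moreover have "f p = p" "f a = t"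
    using f_eq B(2) by auto
  \<comment> \<open>An automorphism would reflect \<open>p \<sqsubseteq> t\<close> to
    \<open>p \<sqsubseteq> a\<close>.\<close>
  ultimately show False
    using p a(1) pa t by (auto simp: poset_automorphism_def)
qed

end

theorem theorem7p1:
  fixes \<kappa> :: "'k rel" and P :: "'a set" and R :: "'a rel"
  assumes "Card_order \<kappa>" and "natLeq \<le>o \<kappa>" and "regularCard \<kappa>"
    and "partial_order_on P R" and "|P| =o \<kappa>"
    and "upwards_directed \<kappa> P R" and "downwards_directed \<kappa> P R"
    and "\<forall>p\<in>P. \<forall>q\<in>P. (p, q) \<in> R \<longrightarrow>
      (\<exists>a\<in>P. incomparable_to_set R a (closed_interval R p q))"
    and "\<forall>p\<in>P. \<forall>q\<in>P. \<forall>r\<in>P. \<exists>\<eta>\<in>partial_condensations P R.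
      dom \<eta> = closed_interval R p q \<and> ran \<eta> \<subseteq> under R r"
    and "\<forall>p\<in>P. \<forall>q\<in>P. \<forall>r\<in>P. \<exists>\<eta>\<in>partial_condensations P R.
      dom \<eta> = closed_interval R p q \<and> ran \<eta> \<subseteq> above R r"
  shows "\<not> reversible P R"
  by (rule two_way_directed_poset.not_reversible[where \<kappa> = \<kappa>], unfold_locales) (use assms in blast)+

end
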